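(* Let $p_1,\ldots,p_r$ be distinct primes ($r \ge 1$), let $\mathbf{x} \in \mathbb{Q}_P = \mathbb{R}\times\mathbb{Q}_{p_1}\times\cdots\times\mathbb{Q}_{p_r}$, and let $N \in \mathbb{N}$. Then there exist $\beta,\gamma \in P^{-1}\mathbb{Z}$ with $\ell(\gamma) \le N$ and $\gamma > 0$ such that $$d(\gamma\mathbf{x}, \iota(\beta)) \le \frac{M}{N},$$ where $M = \max\{p_1,\ldots,p_r\}$.
   Context: $P = \{\infty, p_1,\ldots,p_r\}$ is a set of places of $\mathbb{Q}$ with $p_1,\ldots,p_r$ distinct primes, and $\mathbb{Q}_P = \prod_{p\in P}\mathbb{Q}_p = \mathbb{R}\times\mathbb{Q}_{p_1}\times\cdots\times\mathbb{Q}_{p_r}$. $P^{-1}\mathbb{Z} = \{ n p_1^{\nu_1}\cdots p_r^{\nu_r} : n,\nu_1,\ldots,\nu_r \in \mathbb{Z}\} \subset \mathbb{Q}$. $\iota:\mathbb{Q}\to\mathbb{Q}_P$ is the diagonal embedding $\gamma \mapsto (\gamma,\gamma,\ldots,\gamma)$. For $\mathbf{x}=(x_\infty,x_{p_1},\ldots,x_{p_r})$, $\mathbf{y}=(y_\infty,y_{p_1},\ldots,y_{p_r}) \in \mathbb{Q}_P$, $d(\mathbf{x},\mathbf{y}) = \max_{p\in P}|x_p-y_p|_p$, where $|\cdot|_\infty$ is the usual absolute value and $|\cdot|_{p}$ the $p$-adic absolute value normalised by $|p|_p = p^{-1}$. For $\gamma \in P^{-1}\mathbb{Z}$, the level is $\ell(\gamma)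 = \max_{p\in P}|\gamma|_p$. Multiplication $\gamma\mathbf{x}$ is coordinatewise. *)

theory Defs
  imports Complex_Main "HOL-Computational_Algebra.Primes" "HOL-Algebra.QuotRing"
begin

section \<open>The $p$-adic absolute value on the rationals\<close>

definition padic_val :: "nat \<Rightarrow> rat \<Rightarrow> int" where
  "padic_val p x =
     int (multiplicity (int p) (fst (quotient_of x))) -
     int (multiplicity (int p) (snd (quotient_of x)))"

definition padic_abs :: "nat \<Rightarrow> rat \<Rightarrow> real" where
  "padic_abs p x = (if x = 0 then 0 else real p powi (- padic_val p x))"

lemma padic_abs_divide:
  assumes p: "prime p" and ab: "a \<noteq> 0" "b \<noteq> 0"
  shows "padic_abs p (of_int a / of_int b) =
           real p powi (int (multiplicity (int p) b) - int (multiplicity (int p) a))"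
proof -
  define x :: rat where "x = of_int a / of_int b"
  obtain n d where nd: "quotient_of x = (n, d)" by force
  have d: "d > 0" using quotient_of_denom_pos[OF nd] .
  have x: "x = of_int n / of_int d" using quotient_of_div[OF nd] .
  have x0: "x \<noteq> 0" using ab by (simp add: x_def)
  then have n: "n \<noteq> 0" using x by auto
  have "rat_of_int (n * b) = rat_of_int (a * d)"
    using x x_def ab d by (simp add: field_simps)
  then have e: "n * b = a * d" by (simp only: of_int_eq_iff)
  have pe: "prime_elem (int p)" using p by simp
  have "multiplicity (int p) n + multiplicity (int p) b =
        multiplicity (int p) a + multiplicity (int p) d"
    using arg_cong[OF e, of "multiplicity (int p)"] ab n d
    by (simp add: prime_elem_multiplicity_mult_distrib[OF pe])
  then have "- padic_val p x = int (multiplicity (int p) b) - int (multiplicity (int p) a)"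
    by (simp add: padic_val_def nd)
  with x0 show ?thesis by (simp add: padic_abs_def x_def)
qed

lemma padic_abs_0 [simp]: "padic_abs p 0 = 0"
  by (simp add: padic_abs_def)

lemma padic_abs_1 [simp]: "padic_abs p 1 = 1"
  by (simp add: padic_abs_def padic_val_def)

lemma padic_abs_nonneg [simp]: "padic_abs p x \<ge> 0"
  by (simp add: padic_abs_def)

lemma padic_abs_eq_0_iff [simp]: "prime p \<Longrightarrow> padic_abs p x = 0 \<longleftrightarrow> x = 0"
  by (auto simp: padic_abs_def power_int_0_left_if)

lemma padic_abs_mult:
  assumes p: "prime p"
  shows "padic_abs p (x * y) = padic_abs p x * padic_abs p y"
proof (cases "x = 0 \<or> y = 0")
  case False
  obtain a b where x: "x = of_int a / of_int b" "b \<noteq> 0"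
    by (metis quotient_of_div quotient_of_denom_pos surj_pair order_less_irrefl)
  obtain c d where y: "y = of_int c / of_int d" "d \<noteq> 0"
    by (metis quotient_of_div quotient_of_denom_pos surj_pair order_less_irrefl)
  have ac: "a \<noteq> 0" "c \<noteq> 0" using False x y by auto
  have xy: "x * y = of_int (a * c) / of_int (b * d)" using x y by simp
  have pe: "prime_elem (int p)" using p by simp
  have p0: "real p \<noteq> 0" using p by (auto simp: prime_gt_0_nat)
  show ?thesis
    unfolding xy unfolding x y
    using p ac x y p0
    by (subst (1 2 3) padic_abs_divide)
       (simp_all add: prime_elem_multiplicity_mult_distrib[OF pe] algebra_simps flip: power_int_add)
qed auto

lemma padic_abs_minus [simp]:
  assumes p: "prime p"
  shows "padic_abs p (- x) = padic_abs p x"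
proof (cases "x = 0")
  case False
  obtain a b where x: "x = of_int a / of_int b" "b \<noteq> 0"
    by (metis quotient_of_div quotient_of_denom_pos surj_pair order_less_irrefl)
  have a: "a \<noteq> 0" using False x by auto
  have m: "multiplicity (int p) (- a) = multiplicity (int p) a"
    using multiplicity_times_unit_right[of "- 1" "int p" a] by simp
  have "- x = of_int (- a) / of_int b" using x by simp
  then show ?thesis
    using padic_abs_divide[OF p, of a b] padic_abs_divide[OF p, of "- a" b] a x m by simp
qed auto

lemma padic_abs_diff_commute: "prime p \<Longrightarrow> padic_abs p (x - y) = padic_abs p (y - x)"
  using padic_abs_minus[of p "x - y"] by simp

lemma padic_abs_int_le_1:
  assumes p: "prime p"
  shows "padic_abs p (of_int a) \<le> 1"
proof (cases "a = 0")
  case False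
  have "real p \<ge> 1" using prime_ge_1_nat[OF p] by simp
  then have "inverse (real p ^ k) \<le> 1" for k
    by (simp add: one_le_power inverse_le_1_iff)
  then show ?thesis
    using padic_abs_divide[OF p False, of 1] by (simp add: power_int_minus)
qed auto

lemma padic_abs_le_1_iff:
  assumes p: "prime p" and "b \<noteq> 0"
  shows "padic_abs p (of_int a / of_int b) \<le> 1 \<longleftrightarrow>
           a = 0 \<or> multiplicity (int p) b \<le> multiplicity (int p) a"
proof (cases "a = 0")
  case False
  have p1: "real p > 1" using prime_gt_1_nat[OF p] by simp
  have "real p powi k \<le> 1 \<longleftrightarrow> k \<le> 0" for k
    using power_int_increasing[of k 0 "real p"] power_int_strict_increasing[of 0 k "real p"] p1
    by (cases "k \<le> 0") auto
  with False show ?thesis by (simp add: padic_abs_divide[OF p False assms(2)])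
qed auto

lemma padic_abs_one_plus:
  assumes p: "prime p" and x: "padic_abs p x \<le> 1"
  shows "padic_abs p (1 + x) \<le> 1"
proof -
  obtain a b where ab: "quotient_of x = (a, b)" by force
  have xab: "x = of_int a / of_int b" and b: "b > 0" and cop: "coprime a b"
    using quotient_of_div[OF ab] quotient_of_denom_pos[OF ab] quotient_of_coprime[OF ab] by auto
  have nd: "\<not> int p dvd b"
  proof
    assume d: "int p dvd b"
    show False
    proof (cases "a = 0")
      case True
      then have "b = 1" using cop b by simp
      then show False using d p by auto
    next
      case False
      have "multiplicity (int p) b > 0"
        using d b p by (simp add: prime_multiplicity_gt_zero_iff)
      moreover have "multiplicity (int p) b \<le> multiplicity (int p) a"
        using x xab padic_abs_le_1_iff[OF p, of b a] b False by simp
      ultimately have "int p dvd a"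
        using not_dvd_imp_multiplicity_0[of "int p" a] by linarith
      then have "is_unit (int p)" using cop d by (meson coprime_common_divisor)
      then show False using p by auto
    qed
  qed
  have "1 + x = of_int (a + b) / of_int b" using xab b by (simp add: field_simps)
  then show ?thesis
    using padic_abs_le_1_iff[OF p, of b "a + b"] b not_dvd_imp_multiplicity_0[OF nd] by simp
qed

lemma padic_abs_add_le_max:
  assumes p: "prime p"
  shows "padic_abs p (x + y) \<le> max (padic_abs p x) (padic_abs p y)"
proof -
  have *: "padic_abs p (u + v) \<le> padic_abs p v" if uv: "padic_abs p u \<le> padic_abs p v" for u v
  proof (cases "v = 0")
    case True
    with uv have "padic_abs p u = 0" by (metis padic_abs_0 padic_abs_nonneg order_antisym)
    with True p show ?thesis by simp
  next
    case False
    have vp: "padic_abs p v > 0"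
      using False p padic_abs_nonneg[of p v] by (metis padic_abs_eq_0_iff order_le_less)
    have "padic_abs p (u / v) * padic_abs p v = padic_abs p u"
      using False by (simp flip: padic_abs_mult[OF p])
    then have "padic_abs p (u / v) \<le> 1"
      using uv vp mult_le_cancel_right[of "padic_abs p (u / v)" "padic_abs p v" 1] by simp
    then have "padic_abs p (1 + u / v) \<le> 1" by (rule padic_abs_one_plus[OF p])
    moreover have "padic_abs p (u + v) = padic_abs p (1 + u / v) * padic_abs p v"
    proof -
      have "(1 + u / v) * v = u + v" using False by (simp add: distrib_right)
      then show ?thesis by (metis padic_abs_mult[OF p])
    qed
    ultimately show ?thesis using vp by simp
  qed
  show ?thesis using *[of x y] *[of y x] by (auto simp: max_def add.commute)
qed

lemma padic_abs_triangle:
  assumes "prime p"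
  shows "padic_abs p (x + y) \<le> padic_abs p x + padic_abs p y"
  using padic_abs_add_le_max[OF assms, of x y] padic_abs_nonneg[of p x] padic_abs_nonneg[of p y]
  by linarith

lemma padic_abs_triangle_diff:
  assumes p: "prime p"
  shows "\<bar>padic_abs p x - padic_abs p y\<bar> \<le> padic_abs p (x - y)"
  using padic_abs_triangle[OF p, of "x - y" y] padic_abs_triangle[OF p, of "y - x" x]
    padic_abs_diff_commute[OF p, of x y] by simp


section \<open>The $p$-adic numbers\<close>

text \<open>
  The completion of the rationals with respect to \<^term>\<open>padic_abs p\<close>: the ring of Cauchy
  sequences modulo the ideal of null sequences. The carrier depends on the value \<^term>\<open>p\<close>,
  so the result is a ring in the sense of HOL-Algebra and not a type.
\<close>

definition padic_Cauchy :: "nat \<Rightarrow> (nat \<Rightarrow> rat) \<Rightarrow> bool" where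
  "padic_Cauchy p X \<longleftrightarrow>
     (\<forall>e>0. \<exists>k. \<forall>m\<ge>k. \<forall>n\<ge>k. padic_abs p (X m - X n) < e)"

definition padic_Cauchy_ring :: "nat \<Rightarrow> (nat \<Rightarrow> rat) ring" where
  "padic_Cauchy_ring p =
     \<lparr>carrier = {X. padic_Cauchy p X},
      mult = (\<lambda>X Y n. X n * Y n), one = (\<lambda>n. 1),
      zero = (\<lambda>n. 0), add = (\<lambda>X Y n. X n + Y n)\<rparr>"

definition padic_null :: "nat \<Rightarrow> (nat \<Rightarrow> rat) set" where
  "padic_null p = {X. (\<lambda>n. padic_abs p (X n)) \<longlonglongrightarrow> 0}"

definition Q_padic :: "nat \<Rightarrow> (nat \<Rightarrow> rat) set ring" where
  "Q_padic p = padic_Cauchy_ring p Quot padic_null p"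

definition padic_of_rat :: "nat \<Rightarrow> rat \<Rightarrow> (nat \<Rightarrow> rat) set" where
  "padic_of_rat p q = padic_null p +>\<^bsub>padic_Cauchy_ring p\<^esub> (\<lambda>n. q)"

text \<open>The limit does not depend on the representative, see \<open>padic_norm_coset\<close> below.\<close>

definition padic_norm :: "nat \<Rightarrow> (nat \<Rightarrow> rat) set \<Rightarrow> real" where
  "padic_norm p x = (THE L. \<forall>X\<in>x. (\<lambda>n. padic_abs p (X n)) \<longlonglongrightarrow> L)"

lemma padic_Cauchy_const [simp]: "padic_Cauchy p (\<lambda>n. q)"
  by (simp add: padic_Cauchy_def)

lemma padic_Cauchy_add:
  assumes p: "prime p" and X: "padic_Cauchy p X" and Y: "padic_Cauchy p Y"
  shows "padic_Cauchy p (\<lambda>n. X n + Y n)"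
  unfolding padic_Cauchy_def
proof (intro allI impI)
  fix e :: real assume e: "e > 0"
  obtain k where k: "\<And>m n. m \<ge> k \<Longrightarrow> n \<ge> k \<Longrightarrow> padic_abs p (X m - X n) < e"
    using X e unfolding padic_Cauchy_def by metis
  obtain l where l: "\<And>m n. m \<ge> l \<Longrightarrow> n \<ge> l \<Longrightarrow> padic_abs p (Y m - Y n) < e"
    using Y e unfolding padic_Cauchy_def by metis
  have "padic_abs p (X m + Y m - (X n + Y n)) < e" if "m \<ge> max k l" "n \<ge> max k l" for m n
    using padic_abs_add_le_max[OF p, of "X m - X n" "Y m - Y n"] k[of m n] l[of m n] that
    by (simp add: algebra_simps)
  then show "\<exists>k. \<forall>m\<ge>k. \<forall>n\<ge>k. padic_abs p (X m + Y m - (X n + Y n)) < e" by blast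
qed

lemma padic_Cauchy_uminus:
  assumes p: "prime p" and X: "padic_Cauchy p X"
  shows "padic_Cauchy p (\<lambda>n. - X n)"
  using X padic_abs_diff_commute[OF p] by (simp add: padic_Cauchy_def)

lemma padic_Cauchy_convergent:
  assumes p: "prime p" and X: "padic_Cauchy p X"
  shows "convergent (\<lambda>n. padic_abs p (X n))"
proof (rule Cauchy_convergent, rule metric_CauchyI)
  fix e :: real assume "e > 0"
  then obtain k where k: "\<And>m n. m \<ge> k \<Longrightarrow> n \<ge> k \<Longrightarrow> padic_abs p (X m - X n) < e"
    using X unfolding padic_Cauchy_def by metis
  then show "\<exists>M. \<forall>m\<ge>M. \<forall>n\<ge>M. dist (padic_abs p (X m)) (padic_abs p (X n)) < e"
    using padic_abs_triangle_diff[OF p] unfolding dist_real_def by (meson le_less_trans)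
qed

lemma padic_Cauchy_bounded:
  assumes "prime p" "padic_Cauchy p X"
  obtains B where "B > 0" "\<And>n. padic_abs p (X n) \<le> B"
proof -
  have "Bseq (\<lambda>n. padic_abs p (X n))"
    using padic_Cauchy_convergent[OF assms] by (rule convergent_imp_Bseq)
  then show ?thesis using that by (auto simp: Bseq_def)
qed

lemma padic_Cauchy_mult:
  assumes p: "prime p" and X: "padic_Cauchy p X" and Y: "padic_Cauchy p Y"
  shows "padic_Cauchy p (\<lambda>n. X n * Y n)"
  unfolding padic_Cauchy_def
proof (intro allI impI)
  fix e :: real assume e: "e > 0"
  obtain A where A: "A > 0" "\<And>n. padic_abs p (X n) \<le> A" using padic_Cauchy_bounded[OF p X] by blast
  obtain B where B: "B > 0" "\<And>n. padic_abs p (Y n) \<le> B" using padic_Cauchy_bounded[OF p Y] by blast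
  have eB: "e / B > 0" and eA: "e / A > 0" using e A B by auto
  obtain k where k: "\<And>m n. m \<ge> k \<Longrightarrow> n \<ge> k \<Longrightarrow> padic_abs p (X m - X n) < e / B"
    using X eB unfolding padic_Cauchy_def by metis
  obtain l where l: "\<And>m n. m \<ge> l \<Longrightarrow> n \<ge> l \<Longrightarrow> padic_abs p (Y m - Y n) < e / A"
    using Y eA unfolding padic_Cauchy_def by metis
  have "padic_abs p (X m * Y m - X n * Y n) < e" if mn: "m \<ge> max k l" "n \<ge> max k l" for m n
  proof -
    have "padic_abs p ((X m - X n) * Y m) \<le> padic_abs p (X m - X n) * B"
      using B by (simp add: padic_abs_mult[OF p] mult_left_mono)
    also have "\<dots> < e" using k[of m n] mn B by (simp add: field_simps)
    finally have 1: "padic_abs p ((X m - X n) * Y m) < e" .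
    have "padic_abs p (X n * (Y m - Y n)) \<le> A * padic_abs p (Y m - Y n)"
      using A by (simp add: padic_abs_mult[OF p] mult_right_mono)
    also have "\<dots> < e" using l[of m n] mn A by (simp add: field_simps)
    finally have 2: "padic_abs p (X n * (Y m - Y n)) < e" .
    have "X m * Y m - X n * Y n = (X m - X n) * Y m + X n * (Y m - Y n)"
      by (simp add: algebra_simps)
    with padic_abs_add_le_max[OF p, of "(X m - X n) * Y m" "X n * (Y m - Y n)"] 1 2
    show ?thesis by simp
  qed
  then show "\<exists>k. \<forall>m\<ge>k. \<forall>n\<ge>k. padic_abs p (X m * Y m - X n * Y n) < e" by blast
qed

lemma padic_null_imp_Cauchy:
  assumes p: "prime p" and X: "X \<in> padic_null p"
  shows "padic_Cauchy p X"
  unfolding padic_Cauchy_def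
proof (intro allI impI)
  fix e :: real assume "e > 0"
  then obtain k where k: "\<And>n. n \<ge> k \<Longrightarrow> padic_abs p (X n) < e"
    using X unfolding padic_null_def LIMSEQ_def by auto
  have "padic_abs p (X m - X n) < e" if "m \<ge> k" "n \<ge> k" for m n
    using padic_abs_add_le_max[OF p, of "X m" "- X n"] k[of m] k[of n] that p by simp
  then show "\<exists>k. \<forall>m\<ge>k. \<forall>n\<ge>k. padic_abs p (X m - X n) < e" by blast
qed

lemma padic_null_add:
  assumes p: "prime p" and "X \<in> padic_null p" "Y \<in> padic_null p"
  shows "(\<lambda>n. X n + Y n) \<in> padic_null p"
proof -
  have "(\<lambda>n. padic_abs p (X n) + padic_abs p (Y n)) \<longlonglongrightarrow> 0"
    using assms by (auto simp: padic_null_def intro: tendsto_add_zero)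
  then have "(\<lambda>n. padic_abs p (X n + Y n)) \<longlonglongrightarrow> 0"
    by (rule tendsto_sandwich[OF _ _ tendsto_const, rotated 2])
       (simp_all add: padic_abs_triangle[OF p])
  then show ?thesis by (simp add: padic_null_def)
qed

lemma padic_null_mult:
  assumes p: "prime p" and X: "X \<in> padic_null p" and Y: "padic_Cauchy p Y"
  shows "(\<lambda>n. X n * Y n) \<in> padic_null p"
proof -
  have "(\<lambda>n. padic_abs p (X n) * padic_abs p (Y n)) \<longlonglongrightarrow> 0"
  proof -
    obtain L where "(\<lambda>n. padic_abs p (Y n)) \<longlonglongrightarrow> L"
      using padic_Cauchy_convergent[OF p Y] by (auto simp: convergent_def)
    with X have "(\<lambda>n. padic_abs p (X n) * padic_abs p (Y n)) \<longlonglongrightarrow> 0 * L"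
      unfolding padic_null_def by (intro tendsto_mult) auto
    then show ?thesis by simp
  qed
  then show ?thesis by (simp add: padic_null_def padic_abs_mult[OF p])
qed

lemma cring_padic_Cauchy_ring:
  assumes p: "prime p"
  shows "cring (padic_Cauchy_ring p)"
proof (rule cringI)
  show "abelian_group (padic_Cauchy_ring p)"
    by (rule abelian_groupI)
      (auto simp: padic_Cauchy_ring_def padic_Cauchy_add[OF p] algebra_simps
            intro!: exI[of _ "\<lambda>n. - X n" for X] padic_Cauchy_uminus[OF p])
  show "Group.comm_monoid (padic_Cauchy_ring p)"
    by (rule comm_monoidI)
      (auto simp: padic_Cauchy_ring_def padic_Cauchy_mult[OF p] algebra_simps)
qed (auto simp: padic_Cauchy_ring_def algebra_simps)

lemma ideal_padic_null:
  assumes p: "prime p"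
  shows "ideal (padic_null p) (padic_Cauchy_ring p)"
proof -
  interpret cring "padic_Cauchy_ring p" by (rule cring_padic_Cauchy_ring[OF p])
  have inv: "\<ominus>\<^bsub>padic_Cauchy_ring p\<^esub> X = (\<lambda>n. - X n)" if "padic_Cauchy p X" for X
    by (rule minus_equality)
      (use that padic_Cauchy_uminus[OF p that] in \<open>auto simp: padic_Cauchy_ring_def\<close>)
  show ?thesis
  proof (rule idealI)
    show "ring (padic_Cauchy_ring p)" by (rule ring_axioms)
    show "subgroup (padic_null p) (add_monoid (padic_Cauchy_ring p))"
    proof (rule add.subgroupI)
      show "padic_null p \<subseteq> carrier (padic_Cauchy_ring p)"
        using padic_null_imp_Cauchy[OF p] by (auto simp: padic_Cauchy_ring_def)
      show "padic_null p \<noteq> {}"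
        by (auto simp: padic_null_def intro!: exI[of _ "\<lambda>n. 0"])
      show "\<ominus>\<^bsub>padic_Cauchy_ring p\<^esub> X \<in> padic_null p" if "X \<in> padic_null p" for X
        using that p by (simp add: inv padic_null_imp_Cauchy[OF p]) (simp add: padic_null_def)
      show "X \<oplus>\<^bsub>padic_Cauchy_ring p\<^esub> Y \<in> padic_null p"
        if "X \<in> padic_null p" "Y \<in> padic_null p" for X Y
        using padic_null_add[OF p that] by (simp add: padic_Cauchy_ring_def)
    qed
    show "X \<otimes>\<^bsub>padic_Cauchy_ring p\<^esub> Y \<in> padic_null p"
      "Y \<otimes>\<^bsub>padic_Cauchy_ring p\<^esub> X \<in> padic_null p"
      if "X \<in> padic_null p" "Y \<in> carrier (padic_Cauchy_ring p)" for X Y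
      using padic_null_mult[OF p that(1), of Y] that(2)
      by (auto simp: padic_Cauchy_ring_def mult.commute)
  qed
qed

lemma cring_Q_padic: "prime p \<Longrightarrow> cring (Q_padic p)"
  unfolding Q_padic_def
  by (rule ideal.quotient_is_cring[OF ideal_padic_null cring_padic_Cauchy_ring])

lemma padic_norm_coset:
  assumes p: "prime p" and X: "padic_Cauchy p X"
  shows "(\<lambda>n. padic_abs p (X n)) \<longlonglongrightarrow>
           padic_norm p (padic_null p +>\<^bsub>padic_Cauchy_ring p\<^esub> X)"
proof -
  let ?x = "padic_null p +>\<^bsub>padic_Cauchy_ring p\<^esub> X"
  have x: "?x = {(\<lambda>n. Z n + X n) | Z. Z \<in> padic_null p}"
    by (auto simp: a_r_coset_def r_coset_def padic_Cauchy_ring_def)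
  obtain L where L: "(\<lambda>n. padic_abs p (X n)) \<longlonglongrightarrow> L"
    using padic_Cauchy_convergent[OF p X] by (auto simp: convergent_def)
  have all: "(\<lambda>n. padic_abs p (Y n)) \<longlonglongrightarrow> L" if Y: "Y \<in> ?x" for Y
  proof -
    obtain Z where Z: "(\<lambda>n. padic_abs p (Z n)) \<longlonglongrightarrow> 0" and YZ: "Y = (\<lambda>n. Z n + X n)"
      using Y x by (auto simp: padic_null_def)
    have le: "\<bar>padic_abs p (Y n) - padic_abs p (X n)\<bar> \<le> padic_abs p (Z n)" for n
      using padic_abs_triangle_diff[OF p, of "Y n" "X n"] by (simp add: YZ)
    have "(\<lambda>n. padic_abs p (Y n) - padic_abs p (X n)) \<longlonglongrightarrow> 0"
      by (rule tendsto_rabs_zero_cancel,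
          rule tendsto_sandwich[OF _ _ tendsto_const Z]) (use le in auto)
    from tendsto_add[OF this L] show ?thesis by simp
  qed
  have Xx: "X \<in> ?x"
    unfolding x by (auto simp: padic_null_def intro!: exI[of _ "\<lambda>n. 0"])
  have "padic_norm p ?x = L"
    unfolding padic_norm_def
    by (rule the_equality) (use all Xx L LIMSEQ_unique in blast)+
  with L show ?thesis by simp
qed

lemma padic_norm_of_rat [simp]:
  assumes "prime p"
  shows "padic_norm p (padic_of_rat p q) = padic_abs p q"
  using padic_norm_coset[OF assms padic_Cauchy_const[of p q]]
  by (simp add: padic_of_rat_def LIMSEQ_const_iff)


section \<open>The ring $\mathbf{Q}_P$\<close>

text \<open>
  The set \<^term>\<open>S\<close> consists of the finite places, so that $P = \{\infty\} \cup S$. An element of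
  $\mathbf{Q}_P$ is a pair of its real coordinate and the family of its $p$-adic coordinates.
\<close>

type_synonym QP = "real \<times> (nat \<Rightarrow> (nat \<Rightarrow> rat) set)"

definition QP_carrier :: "nat set \<Rightarrow> QP set" where
  "QP_carrier S = UNIV \<times> (\<Pi>\<^sub>E p\<in>S. carrier (Q_padic p))"

definition QP_diag :: "nat set \<Rightarrow> rat \<Rightarrow> QP" where
  "QP_diag S q = (of_rat q, \<lambda>p\<in>S. padic_of_rat p q)"

definition QP_scale :: "nat set \<Rightarrow> rat \<Rightarrow> QP \<Rightarrow> QP" where
  "QP_scale S q x =
     (of_rat q * fst x, \<lambda>p\<in>S. padic_of_rat p q \<otimes>\<^bsub>Q_padic p\<^esub> snd x p)"

definition QP_dist :: "nat set \<Rightarrow> QP \<Rightarrow> QP \<Rightarrow> real" where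
  "QP_dist S x y =
     Max (insert \<bar>fst x - fst y\<bar>
       ((\<lambda>p. padic_norm p (snd x p \<ominus>\<^bsub>Q_padic p\<^esub> snd y p)) ` S))"

definition P_inv_Z :: "nat set \<Rightarrow> rat set" where
  "P_inv_Z S = {of_int n * (\<Prod>p\<in>S. of_nat p powi \<nu> p) | n (\<nu> :: nat \<Rightarrow> int). True}"

definition level :: "nat set \<Rightarrow> rat \<Rightarrow> real" where
  "level S q = Max (insert \<bar>of_rat q\<bar> ((\<lambda>p. padic_abs p q) ` S))"

end

theory Submission
  imports Defs "HOL-Number_Theory.Cong" "HOL-Analysis.Kronecker_Approximation_Theorem"
begin

text \<open>
  By strong approximation there is a single $\xi \in P^{-1}\mathbf{Z}$ with
  $|x_p - \xi|_p \le N^{-2}$ for every finite place $p$. Choose $a_p$ with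
  $p^{a_p} \le N < p^{a_p+1}$ and put $D = \prod_p p^{a_p}$. Dirichlet's approximation theorem,
  applied to $(x_\infty - \xi)/D^2$ with denominators up to $ND$, yields integers
  $0 < k \le ND$ and $h$ with $|k(x_\infty - \xi)/D^2 - h| < 1/(ND)$. Then $\gamma = k/D$ and
  $\beta = \gamma\xi + hD$ work: the real error is less than $1/N$, and the error at $p$ is at
  most $\max(|\gamma|_p N^{-2}, |D|_p) \le \max(N^{-1}, p^{-a_p}) \le p/N$.
\<close>

section \<open>Strong approximation\<close>

lemma padic_abs_power: "prime p \<Longrightarrow> padic_abs p (x ^ n) = padic_abs p x ^ n"
  by (induction n) (simp_all add: padic_abs_mult)

lemma padic_abs_prod:
  assumes "prime p"
  shows "padic_abs p (prod f A) = (\<Prod>x\<in>A. padic_abs p (f x))"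
  using assms by (induction A rule: infinite_finite_induct) (simp_all add: padic_abs_mult)

lemma padic_abs_prime:
  assumes "prime p" "prime q"
  shows "padic_abs p (of_nat q) = (if q = p then inverse (real p) else 1)"
proof -
  have "multiplicity (int p) (int q) = (if q = p then 1 else 0)"
    using assms by (auto simp: prime_multiplicity_other)
  then show ?thesis
    using padic_abs_divide[OF assms(1), of "int q" 1] assms
    by (auto simp: power_int_minus dest: prime_gt_0_nat)
qed

text \<open>Every prime other than \<open>p\<close> is a unit for the \<open>p\<close>-adic absolute
  value, so only the factor at \<open>q = p\<close> contributes.\<close>

lemma padic_abs_prod_primes:
  assumes "finite S" "\<And>q. q \<in> S \<Longrightarrow> prime q" "p \<in> S"
  shows "padic_abs p (\<Prod>q\<in>S. of_nat q ^ a q) = inverse (real p) ^ a p"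
proof -
  have "padic_abs p (\<Prod>q\<in>S. of_nat q ^ a q) =
      (\<Prod>q\<in>S. if q = p then inverse (real p) ^ a p else 1)"
    unfolding padic_abs_prod[OF assms(2)[OF assms(3)]]
    using assms by (intro prod.cong) (auto simp: padic_abs_power padic_abs_prime)
  also have "\<dots> = inverse (real p) ^ a p" using assms by simp
  finally show ?thesis .
qed

lemma padic_abs_of_int_dvd_le:
  assumes p: "prime p" and "int p ^ k dvd z"
  shows "padic_abs p (of_int z) \<le> inverse (real p) ^ k"
proof -
  obtain w where "z = int p ^ k * w" using assms(2) by blast
  then have "padic_abs p (of_int z) = inverse (real p) ^ k * padic_abs p (of_int w)"
    using p by (simp add: padic_abs_mult padic_abs_power padic_abs_prime)
  also have "\<dots> \<le> inverse (real p) ^ k"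
    using padic_abs_int_le_1[OF p, of w] by (intro mult_left_le) auto
  finally show ?thesis .
qed

text \<open>The ultrametric inequality lets approximations be chained without the loss of a factor
  2.\<close>

lemma padic_abs_diff_le:
  assumes "prime p" "padic_abs p (x - y) \<le> e" "padic_abs p (y - z) \<le> e"
  shows "padic_abs p (x - z) \<le> e"
  using padic_abs_add_le_max[of p "x - y" "y - z"] assms by simp

section \<open>Approximation of p-adically integral rationals by integers\<close>

text \<open>In lowest terms \<open>y = a / b\<close> has a denominator prime to \<open>p\<close>,
  which therefore has an inverse \<open>c\<close> modulo \<open>p ^ k\<close>; the integer is
  \<open>a * c\<close>.\<close>

lemma padic_integer_approx:
  assumes p: "prime p" and y: "padic_abs p y \<le> 1"
  obtains z :: int where "padic_abs p (y - of_int z) \<le> inverse (real p) ^ k"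
proof -
  obtain a b where ab: "quotient_of y = (a, b)" by force
  have yab: "y = of_int a / of_int b" and b: "b > 0" and cop: "coprime a b"
    using quotient_of_div[OF ab] quotient_of_denom_pos[OF ab] quotient_of_coprime[OF ab] by auto
  have pp: "prime (int p)" using p by simp
  \<comment> \<open>Otherwise coprimality would keep \<open>p\<close> out of \<open>a\<close>, and
    the absolute value of \<open>y\<close> would exceed 1.\<close>
  have "\<not> int p dvd b"
  proof
    assume d: "int p dvd b"
    then have "\<not> int p dvd a"
      using cop pp by (meson coprime_common_divisor not_prime_unit)
    then have "a \<noteq> 0" "multiplicity (int p) a = 0"
      by (auto simp: not_dvd_imp_multiplicity_0)
    moreover have "multiplicity (int p) b > 0"
      using d b pp by (simp add: prime_multiplicity_gt_zero_iff)
    ultimately show False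
      using y yab padic_abs_le_1_iff[OF p, of b a] b by simp
  qed
  then have "coprime (int p) b" by (rule prime_imp_coprime[OF pp])
  then have "coprime b (int p ^ k)" by (simp add: coprime_commute)
  then obtain c where "[b * c = 1] (mod int p ^ k)"
    using cong_solve_coprime_int by blast
  then have dvd: "int p ^ k dvd 1 - b * c"
    by (simp add: cong_iff_dvd_diff dvd_diff_commute)
  \<comment> \<open>Since \<open>a = y * b\<close>, the error is \<open>y\<close> times a multiple
    of \<open>p ^ k\<close>.\<close>
  have "y - of_int (a * c) = y * of_int (1 - b * c)"
    using b by (simp add: yab field_simps)
  then have "padic_abs p (y - of_int (a * c)) = padic_abs p y * padic_abs p (of_int (1 - b * c))"
    by (simp only: padic_abs_mult[OF p])
  also have "\<dots> \<le> 1 * inverse (real p) ^ k"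
    using y padic_abs_of_int_dvd_le[OF p dvd] by (intro mult_mono) auto
  finally show ?thesis using that[of "a * c"] by simp
qed

text \<open>Each \<open>y p\<close> is approximated by its own integer \<open>u p\<close>; the
  Chinese remainder theorem for the coprime moduli \<open>p ^ k\<close> then merges these into a
  single one.\<close>

lemma padic_integers_simultaneous_approx:
  assumes S: "finite S" "\<And>p. p \<in> S \<Longrightarrow> prime p"
    and y: "\<And>p. p \<in> S \<Longrightarrow> padic_abs p (y p) \<le> 1"
  obtains z :: int where "\<And>p. p \<in> S \<Longrightarrow> padic_abs p (y p - of_int z) \<le> inverse (real p) ^ k"
proof -
  have "\<exists>z::int. padic_abs p (y p - of_int z) \<le> inverse (real p) ^ k" if "p \<in> S" for p
    using padic_integer_approx S y that by metis
  then obtain u :: "nat \<Rightarrow> int"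
    where u: "\<And>p. p \<in> S \<Longrightarrow> padic_abs p (y p - of_int (u p)) \<le> inverse (real p) ^ k"
    by metis
  have "\<forall>p\<in>S. \<forall>q\<in>S. p \<noteq> q \<longrightarrow> coprime (p ^ k) (q ^ k)"
    using S by (auto simp: primes_coprime)
  \<comment> \<open>The remainder theorem is used over the naturals, so \<open>u p\<close> is
    replaced by its nonnegative residue modulo \<open>p ^ k\<close>, on which \<open>nat\<close>
    loses nothing.\<close>
  then obtain z where z: "\<And>p. p \<in> S \<Longrightarrow> [z = nat (u p mod int (p ^ k))] (mod p ^ k)"
    using chinese_remainder_nat[OF S(1), of "\<lambda>p. p ^ k" "\<lambda>p. nat (u p mod int (p ^ k))"] by blast
  show ?thesis
  proof (rule that)
    fix p assume p: "p \<in> S"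
    have "int p ^ k > 0" using S p by (simp add: prime_gt_0_nat)
    then have "[int z = u p] (mod int p ^ k)"
      using z[OF p] unfolding cong_int_iff[symmetric] by (simp add: cong_def)
    then have "int p ^ k dvd u p - int z"
      by (simp add: cong_iff_dvd_diff dvd_diff_commute)
    then have "padic_abs p (of_int (u p) - of_int (int z)) \<le> inverse (real p) ^ k"
      using padic_abs_of_int_dvd_le S p by (metis of_int_diff)
    with u[OF p] show "padic_abs p (y p - of_int (int z)) \<le> inverse (real p) ^ k"
      using padic_abs_diff_le S p by blast
  qed
qed

section \<open>Arithmetic in the ring \<open>P_inv_Z S\<close>\<close>

text \<open>Writing all elements over powers of the one denominator \<open>\<Prod>S\<close> makes
  closure under sums and products plain fraction arithmetic.\<close>

lemma P_inv_Z_iff: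
  assumes S: "finite S" "\<And>p. p \<in> S \<Longrightarrow> prime p"
  shows "x \<in> P_inv_Z S \<longleftrightarrow> (\<exists>n k. x = of_int n / of_nat (\<Prod>S) ^ k)"
proof
  assume "x \<in> P_inv_Z S"
  then obtain n \<nu> where x: "x = of_int n * (\<Prod>p\<in>S. of_nat p powi \<nu> p)"
    by (auto simp: P_inv_Z_def)
  \<comment> \<open>The sum dominates every single exponent in absolute value, so all
    \<open>\<nu> p + k\<close> are nonnegative and multiplying by the \<open>k\<close>-th power of
    \<open>\<Prod>S\<close> clears all denominators.\<close>
  define k where "k = (\<Sum>p\<in>S. nat \<bar>\<nu> p\<bar>)"
  have "of_nat p powi \<nu> p * of_nat p ^ k = (of_nat (p ^ nat (\<nu> p + int k)) :: rat)"
    if "p \<in> S" for p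
  proof -
    have "nat \<bar>\<nu> p\<bar> \<le> k" unfolding k_def using S that by (intro member_le_sum) auto
    then have "\<nu> p + int k \<ge> 0" by linarith
    moreover have "p > 0" using S that by (simp add: prime_gt_0_nat)
    then have "of_nat p powi \<nu> p * of_nat p ^ k = (of_nat p powi (\<nu> p + int k) :: rat)"
      by (simp add: power_int_add)
    ultimately show ?thesis by (simp add: power_int_def)
  qed
  then have "(\<Prod>p\<in>S. of_nat p powi \<nu> p * of_nat p ^ k) =
      (\<Prod>p\<in>S. of_nat (p ^ nat (\<nu> p + int k)) :: rat)"
    by (intro prod.cong) auto
  then have "x * of_nat (\<Prod>S) ^ k = of_int (n * int (\<Prod>p\<in>S. p ^ nat (\<nu> p + int k)))"
    by (simp add: x mult.assoc prod.distrib prod_power_distrib)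
  moreover have "\<Prod>S > 0" using S by (simp add: prod_pos prime_gt_0_nat)
  ultimately show "\<exists>n k. x = of_int n / of_nat (\<Prod>S) ^ k"
    by (metis nonzero_mult_div_cancel_right of_nat_eq_0_iff less_irrefl power_not_zero)
next
  assume "\<exists>n k. x = of_int n / of_nat (\<Prod>S) ^ k"
  then obtain n k where "x = of_int n / of_nat (\<Prod>S) ^ k" by blast
  then have "x = of_int n * (\<Prod>p\<in>S. of_nat p powi (- int k))"
    by (simp add: power_int_minus divide_inverse prod_power_distrib o_def flip: prod_inversef)
  then show "x \<in> P_inv_Z S"
    unfolding P_inv_Z_def by (auto intro!: exI[of _ n] exI[of _ "\<lambda>_. - int k"])
qed

lemma P_inv_Z_of_int: "of_int n \<in> P_inv_Z S"
  unfolding P_inv_Z_def by (auto intro!: exI[of _ n] exI[of _ "\<lambda>_. 0"])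

lemma P_inv_Z_add:
  assumes S: "finite S" "\<And>p. p \<in> S \<Longrightarrow> prime p"
    and "x \<in> P_inv_Z S" "y \<in> P_inv_Z S"
  shows "x + y \<in> P_inv_Z S"
proof -
  obtain m n k l where "x = of_int m / of_nat (\<Prod>S) ^ k" "y = of_int n / of_nat (\<Prod>S) ^ l"
    using assms P_inv_Z_iff by metis
  moreover have "\<Prod>S > 0" using S by (simp add: prod_pos prime_gt_0_nat)
  ultimately have "x + y =
      of_int (m * int (\<Prod>S) ^ l + n * int (\<Prod>S) ^ k) / of_nat (\<Prod>S) ^ (k + l)"
    by (simp add: add_frac_eq power_add del: of_nat_prod)
  then show ?thesis using P_inv_Z_iff S by blast
qed

lemma P_inv_Z_mult:
  assumes S: "finite S" "\<And>p. p \<in> S \<Longrightarrow> prime p"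
    and "x \<in> P_inv_Z S" "y \<in> P_inv_Z S"
  shows "x * y \<in> P_inv_Z S"
proof -
  obtain m n k l where "x = of_int m / of_nat (\<Prod>S) ^ k" "y = of_int n / of_nat (\<Prod>S) ^ l"
    using assms P_inv_Z_iff by metis
  then have "x * y = of_int (m * n) / of_nat (\<Prod>S) ^ (k + l)"
    by (simp add: power_add)
  then show ?thesis using P_inv_Z_iff S by blast
qed

text \<open>A power \<open>E\<close> of \<open>\<Prod>S\<close> makes every \<open>E * q p\<close>
  p-adically integral. One integer \<open>z\<close> approximates all of these, and
  \<open>z / E\<close> is the required element. Rational targets \<open>q p\<close> suffice because
  the p-adic coordinates are first replaced by rationals.\<close>

lemma strong_approximation:
  assumes S: "finite S" "\<And>p. p \<in> S \<Longrightarrow> prime p" and e: "e > 0"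
  obtains \<xi> where "\<xi> \<in> P_inv_Z S" "\<And>p. p \<in> S \<Longrightarrow> padic_abs p (q p - \<xi>) \<le> e"
proof -
  have inv_le: "inverse (real p) \<le> 1 / 2" if "p \<in> S" for p
    using S(2)[OF that] prime_ge_2_nat[of p] by (simp add: field_simps)
  \<comment> \<open>As \<open>S\<close> is finite, one exponent \<open>j\<close> can serve all
    places at once.\<close>
  have "eventually (\<lambda>j. \<forall>p\<in>S. inverse (real p) ^ j * padic_abs p (q p) \<le> 1) sequentially"
  proof (rule eventually_ball_finite[OF S(1)], rule ballI)
    fix p assume p: "p \<in> S"
    have "(\<lambda>j. inverse (real p) ^ j * padic_abs p (q p)) \<longlonglongrightarrow> 0 * padic_abs p (q p)"
      using inv_le[OF p] by (intro tendsto_mult LIMSEQ_power_zero tendsto_const) auto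
    then have "eventually (\<lambda>j. inverse (real p) ^ j * padic_abs p (q p) < 1) sequentially"
      by (rule order_tendstoD(2)) simp
    then show "eventually (\<lambda>j. inverse (real p) ^ j * padic_abs p (q p) \<le> 1) sequentially"
      by (rule eventually_mono) simp
  qed
  then obtain j where j: "\<And>p. p \<in> S \<Longrightarrow> inverse (real p) ^ j * padic_abs p (q p) \<le> 1"
    by (auto simp: eventually_sequentially)
  define E :: rat where "E = of_nat (\<Prod>S) ^ j"
  have E_abs: "padic_abs p E = inverse (real p) ^ j" if "p \<in> S" for p
    using padic_abs_prod_primes[OF S that, of "\<lambda>_. j"] by (simp add: E_def prod_power_distrib)
  have E0: "E \<noteq> 0"
    using S by (auto simp: E_def dest: prime_gt_0_nat)
  \<comment> \<open>Since every prime is at least 2, this \<open>l\<close> gives precision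
    \<open>e\<close> at all places simultaneously.\<close>
  obtain l where l: "(1 / 2 :: real) ^ l < e"
    using real_arch_pow_inv[OF e, of "1 / 2"] by auto
  obtain z :: int
    \<comment> \<open>The extra \<open>j\<close> digits of precision pay for the later division by
      \<open>E\<close>, whose absolute value is \<open>inverse p ^ j\<close>.\<close>
    where z: "\<And>p. p \<in> S \<Longrightarrow> padic_abs p (E * q p - of_int z) \<le> inverse (real p) ^ (j + l)"
    by (rule padic_integers_simultaneous_approx[OF S, of "\<lambda>p. E * q p" "j + l"])
       (use S j E_abs in \<open>auto simp: padic_abs_mult\<close>)
  show ?thesis
  proof (rule that)
    show "of_int z / E \<in> P_inv_Z S" using P_inv_Z_iff[OF S] E_def by blast
    fix p assume p: "p \<in> S"
    have p0: "real p > 0" using S p by (simp add: prime_gt_0_nat)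
    have "E * q p - of_int z = E * (q p - of_int z / E)" using E0 by (simp add: algebra_simps)
    then have "inverse (real p) ^ j * padic_abs p (q p - of_int z / E)
        \<le> inverse (real p) ^ j * inverse (real p) ^ l"
      using z[OF p] p S(2) by (simp add: padic_abs_mult E_abs power_add)
    then have "padic_abs p (q p - of_int z / E) \<le> inverse (real p) ^ l"
      using p0 by (simp add: mult_le_cancel_left)
    also have "\<dots> \<le> (1 / 2) ^ l" using inv_le[OF p] by (intro power_mono) auto
    finally show "padic_abs p (q p - of_int z / E) \<le> e" using l by simp
  qed
qed

section \<open>Approximation in $\mathbf{Q}_P$\<close>

text \<open>The quotient map is a ring homomorphism, so if \<open>x\<close> is the coset of
  \<open>X\<close>, then \<open>cx - b\<close> is the coset of \<open>c * X n - b\<close>, and its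
  norm is a limit of absolute values of rationals. The same \<open>X\<close> serves all
  \<open>c\<close> and \<open>b\<close>.\<close>

lemma Q_padic_representative:
  assumes p: "prime p" and x: "x \<in> carrier (Q_padic p)"
  obtains X where "padic_Cauchy p X"
    "\<And>c b. (\<lambda>n. padic_abs p (c * X n - b)) \<longlonglongrightarrow>
       padic_norm p (padic_of_rat p c \<otimes>\<^bsub>Q_padic p\<^esub> x \<ominus>\<^bsub>Q_padic p\<^esub> padic_of_rat p b)"
proof -
  let ?R = "padic_Cauchy_ring p" and ?I = "padic_null p"
  interpret h: ring_hom_ring ?R "Q_padic p" "(+>\<^bsub>?R\<^esub>) ?I"
    unfolding Q_padic_def by (rule ideal.rcos_ring_hom_ring[OF ideal_padic_null[OF p]])
  obtain X where X: "padic_Cauchy p X" and xX: "x = ?I +>\<^bsub>?R\<^esub> X"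
    using x by (auto simp: Q_padic_def FactRing_def A_RCOSETS_def' padic_Cauchy_ring_def)
  have carr: "Y \<in> carrier ?R \<longleftrightarrow> padic_Cauchy p Y" for Y
    by (simp add: padic_Cauchy_ring_def)
  show ?thesis
  proof (rule that[OF X])
    fix c b
    have neg: "\<ominus>\<^bsub>?R\<^esub> (\<lambda>n. b) = (\<lambda>n. - b)"
      by (rule h.R.minus_equality) (auto simp: padic_Cauchy_ring_def)
    have cX: "padic_Cauchy p (\<lambda>n. c * X n)"
      by (rule padic_Cauchy_mult[OF p padic_Cauchy_const X])
    have "padic_of_rat p c \<otimes>\<^bsub>Q_padic p\<^esub> x \<ominus>\<^bsub>Q_padic p\<^esub> padic_of_rat p b =
        ?I +>\<^bsub>?R\<^esub> ((\<lambda>n. c) \<otimes>\<^bsub>?R\<^esub> X \<oplus>\<^bsub>?R\<^esub> \<ominus>\<^bsub>?R\<^esub> (\<lambda>n. b))"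
      using carr[of X] carr[of "\<lambda>n. c"] carr[of "\<lambda>n. b"] X
      by (simp add: xX padic_of_rat_def a_minus_def)
    also have "(\<lambda>n. c) \<otimes>\<^bsub>?R\<^esub> X \<oplus>\<^bsub>?R\<^esub> \<ominus>\<^bsub>?R\<^esub> (\<lambda>n. b) = (\<lambda>n. c * X n - b)"
      by (simp add: neg) (simp add: padic_Cauchy_ring_def)
    finally show "(\<lambda>n. padic_abs p (c * X n - b)) \<longlonglongrightarrow>
       padic_norm p (padic_of_rat p c \<otimes>\<^bsub>Q_padic p\<^esub> x \<ominus>\<^bsub>Q_padic p\<^esub> padic_of_rat p b)"
      using padic_norm_coset[OF p padic_Cauchy_add[OF p cX padic_Cauchy_const[of p "- b"]]]
      by simp
  qed
qed

text \<open>The rational \<open>q\<close> is a late term of a Cauchy sequence for \<open>x\<close>,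
  and the bound comes from splitting \<open>cx - b\<close> as
  \<open>c(x - \<xi>) + (c\<xi> - b)\<close>. Here \<open>q\<close> precedes \<open>\<xi>\<close>,
  \<open>c\<close> and \<open>b\<close>, since strong approximation derives \<open>\<xi>\<close>
  from the rationals \<open>q\<close>, and \<open>c\<close>, \<open>b\<close> are built
  afterwards.\<close>

lemma Q_padic_rational_approx:
  assumes p: "prime p" and x: "x \<in> carrier (Q_padic p)" and e: "e > 0"
  obtains q where "\<And>\<xi> c b. padic_abs p (q - \<xi>) \<le> e \<Longrightarrow>
    padic_norm p (padic_of_rat p c \<otimes>\<^bsub>Q_padic p\<^esub> x \<ominus>\<^bsub>Q_padic p\<^esub> padic_of_rat p b)
      \<le> max (padic_abs p c * e) (padic_abs p (c * \<xi> - b))"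
proof -
  obtain X where X: "padic_Cauchy p X"
    and lim: "\<And>c b. (\<lambda>n. padic_abs p (c * X n - b)) \<longlonglongrightarrow>
       padic_norm p (padic_of_rat p c \<otimes>\<^bsub>Q_padic p\<^esub> x \<ominus>\<^bsub>Q_padic p\<^esub> padic_of_rat p b)"
    using Q_padic_representative[OF p x] by blast
  obtain k where k: "\<And>n. n \<ge> k \<Longrightarrow> padic_abs p (X n - X k) < e"
    using X e unfolding padic_Cauchy_def by (metis order_refl)
  show ?thesis
  proof (rule that)
    fix \<xi> c b assume \<xi>: "padic_abs p (X k - \<xi>) \<le> e"
    \<comment> \<open>The bound holds along the whole tail of the sequence and so survives in the
      limit.\<close>
    have "padic_abs p (c * X n - b) \<le> max (padic_abs p c * e) (padic_abs p (c * \<xi> - b))"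
      if "n \<ge> k" for n
    proof -
      have "padic_abs p (X n - \<xi>) \<le> e"
        using padic_abs_diff_le[OF p _ \<xi>] k[OF that] by simp
      then have "padic_abs p (c * (X n - \<xi>)) \<le> padic_abs p c * e"
        by (simp add: padic_abs_mult[OF p] mult_left_mono)
      moreover have "c * (X n - \<xi>) + (c * \<xi> - b) = c * X n - b" by (simp add: algebra_simps)
      then have "padic_abs p (c * X n - b)
          \<le> max (padic_abs p (c * (X n - \<xi>))) (padic_abs p (c * \<xi> - b))"
        using padic_abs_add_le_max[OF p] by metis
      ultimately show ?thesis by linarith
    qed
    then show "padic_norm p (padic_of_rat p c \<otimes>\<^bsub>Q_padic p\<^esub> x \<ominus>\<^bsub>Q_padic p\<^esub> padic_of_rat p b)
      \<le> max (padic_abs p c * e) (padic_abs p (c * \<xi> - b))"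
      by (intro LIMSEQ_le_const2[OF lim] exI[of _ k]) auto
  qed
qed

section \<open>Choice of \<open>\<gamma>\<close> and \<open>\<beta>\<close>, and the error at each
  place\<close>

theorem theorem1:
  fixes S :: "nat set" and x :: QP and N :: nat
  assumes "finite S" and "S \<noteq> {}" and "\<And>p. p \<in> S \<Longrightarrow> prime p"
    and "x \<in> QP_carrier S"
    and "N \<ge> 1"
  shows "\<exists>\<beta>\<in>P_inv_Z S. \<exists>\<gamma>\<in>P_inv_Z S.
           level S \<gamma> \<le> real N \<and> \<gamma> > 0 \<and>
           QP_dist S (QP_scale S \<gamma> x) (QP_diag S \<beta>) \<le> real (Max S) / real N"
proof -
  note S = assms(1,3)
  have N: "real N > 0" using assms(5) by simp
  \<comment> \<open>One factor \<open>1 / N\<close> is spent on the absolute value of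
    \<open>\<gamma>\<close>, which is only known to be at most \<open>N\<close>; the other is the
    error allowed.\<close>
  define e where "e = 1 / (real N * real N)"
  have e: "e > 0" using N by (simp add: e_def)
  have x: "snd x p \<in> carrier (Q_padic p)" if "p \<in> S" for p
    using assms(4) that by (auto simp: QP_carrier_def)
  \<comment> \<open>The lower inequality will bound \<open>\<gamma>\<close> at \<open>p\<close>; the
    upper one costs the factor \<open>p\<close>, hence \<open>Max S\<close>, in the final
    error.\<close>
  have "\<exists>a. p ^ a \<le> N \<and> N < p ^ (a + 1)" if "p \<in> S" for p
    using ex_power_ivl1[OF prime_ge_2_nat assms(5)] S that by blast
  then obtain a where a: "\<And>p. p \<in> S \<Longrightarrow> p ^ a p \<le> N" "\<And>p. p \<in> S \<Longrightarrow> N < p ^ (a p + 1)"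
    by metis
  define D where "D = (\<Prod>p\<in>S. p ^ a p)"
  have D: "D > 0" using S by (simp add: D_def prod_pos prime_gt_0_nat)
  have D_abs: "padic_abs p (of_nat D) = inverse (real p) ^ a p" if "p \<in> S" for p
    using padic_abs_prod_primes[OF S that] by (simp add: D_def)
  have "\<exists>q. \<forall>\<xi> c b. padic_abs p (q - \<xi>) \<le> e \<longrightarrow>
      padic_norm p (padic_of_rat p c \<otimes>\<^bsub>Q_padic p\<^esub> snd x p \<ominus>\<^bsub>Q_padic p\<^esub> padic_of_rat p b)
        \<le> max (padic_abs p c * e) (padic_abs p (c * \<xi> - b))" if "p \<in> S" for p
    using Q_padic_rational_approx[OF S(2)[OF that] x[OF that] e] by metis
  then obtain q where q: "\<And>p \<xi> c b. p \<in> S \<Longrightarrow> padic_abs p (q p - \<xi>) \<le> e \<Longrightarrow>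
      padic_norm p (padic_of_rat p c \<otimes>\<^bsub>Q_padic p\<^esub> snd x p \<ominus>\<^bsub>Q_padic p\<^esub> padic_of_rat p b)
        \<le> max (padic_abs p c * e) (padic_abs p (c * \<xi> - b))"
    by metis
  obtain \<xi> where \<xi>: "\<xi> \<in> P_inv_Z S" "\<And>p. p \<in> S \<Longrightarrow> padic_abs p (q p - \<xi>) \<le> e"
    using strong_approximation[OF S e] by blast
  have ND: "N * D > 0" using assms(5) D by simp
  \<comment> \<open>With \<open>\<gamma> = k / D\<close>, the real error
    \<open>\<gamma>(x - \<xi>) - hD\<close> is \<open>D\<close> times the quantity bounded here,
    which explains the division by the square of \<open>D\<close>. The range up to
    \<open>N * D\<close> gives \<open>\<gamma> \<le> N\<close>.\<close>
  obtain h k where k: "0 < k" "k \<le> int (N * D)"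
    and hk: "\<bar>of_int k * ((fst x - of_rat \<xi>) / (real D)\<^sup>2) - of_int h\<bar> < 1 / real (N * D)"
    using Dirichlet_approx[OF ND] by metis
  define \<gamma> :: rat where "\<gamma> = of_int k / of_nat D"
  \<comment> \<open>The correction is a multiple of \<open>D\<close>, so it is small at all finite
    places while adjusting the real one.\<close>
  define \<beta> where "\<beta> = \<gamma> * \<xi> + of_int h * of_nat D"
  have \<gamma>_pos: "\<gamma> > 0" using k D by (simp add: \<gamma>_def)
  have "\<gamma> = of_int k * (\<Prod>p\<in>S. of_nat p powi (- int (a p)))"
    by (simp add: \<gamma>_def D_def power_int_minus divide_inverse o_def flip: prod_inversef)
  then have \<gamma>: "\<gamma> \<in> P_inv_Z S"
    unfolding P_inv_Z_def by (auto intro!: exI[of _ k] exI[of _ "\<lambda>p. - int (a p)"])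
  have \<beta>: "\<beta> \<in> P_inv_Z S"
    unfolding \<beta>_def using P_inv_Z_of_int[of "h * int D" S]
    by (intro P_inv_Z_add[OF S] P_inv_Z_mult[OF S \<gamma> \<xi>(1)]) simp_all
  have \<gamma>_real: "real_of_rat \<gamma> = of_int k / real D"
    by (simp add: \<gamma>_def of_rat_divide)
  have "real_of_int k \<le> real N * real D"
    using k(2) by (metis of_int_le_iff of_int_of_nat_eq of_nat_mult)
  then have \<gamma>_le: "real_of_rat \<gamma> \<le> real N"
    using D by (simp add: \<gamma>_real divide_le_eq)
  have \<gamma>_abs: "padic_abs p \<gamma> \<le> real N" if "p \<in> S" for p
  proof -
    \<comment> \<open>From \<open>\<gamma> * D = k\<close> with \<open>k\<close> an integer, the
      denominator enlarges the absolute value by at most \<open>p ^ a p\<close>, which is at most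
      \<open>N\<close>.\<close>
    have "padic_abs p \<gamma> * padic_abs p (of_nat D) = padic_abs p (of_int k)"
      using D S(2)[OF that] by (simp add: \<gamma>_def flip: padic_abs_mult)
    moreover have p0: "p > 0" using S that by (simp add: prime_gt_0_nat)
    ultimately have "padic_abs p \<gamma> = padic_abs p (of_int k) * real p ^ a p"
      by (simp add: D_abs that power_inverse field_simps)
    also have "\<dots> \<le> 1 * real N"
      using padic_abs_int_le_1[OF S(2)[OF that], of k] a(1)[OF that]
      by (intro mult_mono) (auto simp flip: of_nat_power)
    finally show ?thesis by simp
  qed
  have level: "level S \<gamma> \<le> real N"
    using assms(1) \<gamma>_le \<gamma>_pos \<gamma>_abs by (simp add: level_def)
  have Max1: "real (Max S) \<ge> 1"
    using S Max_in[OF assms(1,2)] prime_ge_1_nat by auto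
  have real_place: "\<bar>real_of_rat \<gamma> * fst x - real_of_rat \<beta>\<bar> \<le> real (Max S) / real N"
  proof -
    have "real_of_rat \<gamma> * fst x - real_of_rat \<beta> =
        real D * (of_int k * ((fst x - of_rat \<xi>) / (real D)\<^sup>2) - of_int h)"
      using D by (simp add: \<beta>_def \<gamma>_real of_rat_add of_rat_mult field_simps power2_eq_square)
    then have "\<bar>real_of_rat \<gamma> * fst x - real_of_rat \<beta>\<bar> \<le> real D * (1 / real (N * D))"
      using mult_left_mono[OF less_imp_le[OF hk], of "real D"] by (simp add: abs_mult)
    also have "\<dots> = 1 / real N" using D by simp
    also have "\<dots> \<le> real (Max S) / real N" using Max1 N by (simp add: divide_right_mono)
    finally show ?thesis .
  qed
  have finite_place: "padic_norm p (padic_of_rat p \<gamma> \<otimes>\<^bsub>Q_padic p\<^esub> snd x p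
      \<ominus>\<^bsub>Q_padic p\<^esub> padic_of_rat p \<beta>) \<le> real (Max S) / real N" if p: "p \<in> S" for p
  proof -
    have "padic_abs p \<gamma> * e \<le> real N * e"
      using \<gamma>_abs[OF p] e by (simp add: mult_right_mono)
    also have "\<dots> = 1 / real N" using N by (simp add: e_def)
    also have "\<dots> \<le> real (Max S) / real N" using Max1 N by (simp add: divide_right_mono)
    finally have 1: "padic_abs p \<gamma> * e \<le> real (Max S) / real N" .
    have pp: "prime p" and p0: "real p > 0" using S p by (simp_all add: prime_gt_0_nat)
    \<comment> \<open>Only the correction term remains, and \<open>D\<close> contributes
      \<open>inverse p ^ a p\<close>, which is below \<open>p / N\<close> because
      \<open>N < p ^ (a p + 1)\<close>.\<close>
    have "\<gamma> * \<xi> - \<beta> = - (of_int h * of_nat D)" by (simp add: \<beta>_def)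
    then have "padic_abs p (\<gamma> * \<xi> - \<beta>) = padic_abs p (of_int h) * inverse (real p) ^ a p"
      using pp by (simp add: padic_abs_mult D_abs p)
    also have "\<dots> \<le> 1 * inverse (real p) ^ a p"
      using padic_abs_int_le_1[OF pp] by (intro mult_right_mono) auto
    also have "\<dots> \<le> real p / real N"
    proof -
      have "real N \<le> real p * real p ^ a p"
        using a(2)[OF p] by (simp flip: of_nat_power of_nat_mult)
      then show ?thesis using N p0 by (simp add: power_inverse field_simps)
    qed
    also have "\<dots> \<le> real (Max S) / real N"
      using assms(1) p N by (simp add: divide_right_mono)
    finally show ?thesis using q[OF p \<xi>(2)[OF p], of \<gamma> \<beta>] 1 by simp
  qed
  have "QP_dist S (QP_scale S \<gamma> x) (QP_diag S \<beta>) \<le> real (Max S) / real N"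
    using assms(1) real_place finite_place by (simp add: QP_dist_def QP_scale_def QP_diag_def)
  with \<beta> \<gamma> level \<gamma>_pos show ?thesis by blast
qed

end
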